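(* Let $X=(X_n)_{n\geq 0}$ be an irreducible recurrent (discrete-time) Markov chain with finite state space $E$, and let $\big((M_n(x),Q_n(x))_{x\in E}\big)_{n\geq 0}$ be a sequence of independent and identically distributed random vectors, with the same law as $(M(x),Q(x))_{x\in E}$. Assume that for all $x\in E$, $$\mathbb{P}(0\leq M(x)<1)=1,$$ and that for each $x\in E$ there is $v_{|Q(x)|}\in(0,+\infty]$ such that $\mathbb{E}(e^{v|Q(x)|})<+\infty$ if $v<v_{|Q(x)|}$ and $\mathbb{E}(e^{v|Q(x)|})=+\infty$ if $v>v_{|Q(x)|}$. Let $R_0$ be a real random variable with all exponential moments finite (that is, $\mathbb{E}(e^{v|R_0|})<+\infty$ for every $v\geq 0$), and assume that the pair $(X,R_0)$ is independent of the sequence $\big((M_n(x),Q_n(x))_{x\in E}\big)_{n\geq 0}$. Define $(R_n)_{n\geq 0}$ by $$R_{n+1}=M_n(X_n)R_n+Q_n(X_n),\qquad n\geq 0,$$ and set $\underline{v}=\inf_{x\in E}v_{|Q(x)|}$. Then for any $v<\underline{v}$, $$\sup_{n\geq 0}\mathbb{E}\big(e^{v|R_n|}\big)<+\infty .$$ Moreover, if $v>\underline{v}$, then this supremum is infinite.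
   Context: All random variables are defined on a common probability space. The variables $Q(x)$ are real-valued and not assumed to be non-negative; for a fixed $n$, no independence is assumed among the components of the random vector $(M_n(x),Q_n(x))_{x\in E}$. *)

theory Defs
  imports "HOL-Probability.Probability"
begin

definition stochastic_matrix :: "('e::finite \<Rightarrow> 'e \<Rightarrow> real) \<Rightarrow> bool" where
  "stochastic_matrix K \<longleftrightarrow> (\<forall>x y. 0 \<le> K x y) \<and> (\<forall>x. (\<Sum>y\<in>UNIV. K x y) = 1)"

definition markov_chain ::
  "'w measure \<Rightarrow> ('e::finite \<Rightarrow> 'e \<Rightarrow> real) \<Rightarrow> (nat \<Rightarrow> 'w \<Rightarrow> 'e) \<Rightarrow> bool" where
  "markov_chain S K X \<longleftrightarrow>
     stochastic_matrix K \<and>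
     (\<forall>n. X n \<in> measurable S (count_space UNIV)) \<and>
     (\<forall>n (s :: nat \<Rightarrow> 'e) y.
        \<P>(\<omega> in S. \<forall>i\<le>n. X i \<omega> = s i) > 0 \<longrightarrow>
        \<P>(\<omega> in S. X (Suc n) \<omega> = y \<bar> (\<forall>i\<le>n. X i \<omega> = s i)) = K (s n) y)"

primrec n_step :: "('e::finite \<Rightarrow> 'e \<Rightarrow> real) \<Rightarrow> nat \<Rightarrow> 'e \<Rightarrow> 'e \<Rightarrow> real" where
  "n_step K 0 x y = (if x = y then 1 else 0)"
| "n_step K (Suc n) x y = (\<Sum>z\<in>UNIV. K x z * n_step K n z y)"

definition irreducible_chain :: "('e::finite \<Rightarrow> 'e \<Rightarrow> real) \<Rightarrow> bool" where
  "irreducible_chain K \<longleftrightarrow> (\<forall>x y. \<exists>n. n_step K n x y > 0)"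

(* Index shift: with tau_y the first time m >= 1 such that X_m = y,
   first_passage K n x y is the probability that tau_y = n + 1 for the chain started at x.
   Hence the series in recurrent_chain is P_x(tau_x < infinity). *)
primrec first_passage :: "('e::finite \<Rightarrow> 'e \<Rightarrow> real) \<Rightarrow> nat \<Rightarrow> 'e \<Rightarrow> 'e \<Rightarrow> real" where
  "first_passage K 0 x y = K x y"
| "first_passage K (Suc n) x y = (\<Sum>z\<in>UNIV - {y}. K x z * first_passage K n z y)"

definition recurrent_chain :: "('e::finite \<Rightarrow> 'e \<Rightarrow> real) \<Rightarrow> bool" where
  "recurrent_chain K \<longleftrightarrow> (\<forall>x. (\<lambda>n. first_passage K n x x) sums 1)"

definition exp_moment :: "'w measure \<Rightarrow> ('w \<Rightarrow> real) \<Rightarrow> real \<Rightarrow> ennreal" where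
  "exp_moment S Y v = (\<integral>\<^sup>+ \<omega>. ennreal (exp (v * \<bar>Y \<omega>\<bar>)) \<partial>S)"

(* The library's indep_var requires both random variables to have the same value type.
   This is the heterogeneous version: the generated sigma-algebras are independent. *)
definition indep_rvs ::
  "'w measure \<Rightarrow> 'a measure \<Rightarrow> ('w \<Rightarrow> 'a) \<Rightarrow> 'b measure \<Rightarrow> ('w \<Rightarrow> 'b) \<Rightarrow> bool" where
  "indep_rvs S A f B g \<longleftrightarrow>
     f \<in> measurable S A \<and> g \<in> measurable S B \<and>
     prob_space.indep_set S (sets (vimage_algebra (space S) f A))
                            (sets (vimage_algebra (space S) g B))"

abbreviation coeff_space :: "('e \<Rightarrow> real \<times> real) measure" where
  "coeff_space \<equiv> PiM UNIV (\<lambda>_. borel \<Otimes>\<^sub>M borel)"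

end

theory Submission
  imports Defs "HOL-Real_Asymp.Real_Asymp"
begin

text \<open>
  Write \<open>e n = E (exp (v * \<bar>R n\<bar>))\<close>.  Both halves of the dichotomy come from conditioning
  on the state \<open>(X n, R n)\<close>, which is independent of the coefficients used at time \<open>n\<close>
  (lemma \<open>state_coefficient_nn_integral\<close>).

  Below the threshold, \<open>\<bar>R (Suc n)\<bar> \<le> \<bar>M\<bar> * \<bar>R n\<bar> + \<bar>Q\<bar>\<close>, so it suffices to control
  \<open>E (exp (v * (\<bar>M x\<bar> * r + \<bar>Q x\<bar>)))\<close> for a fixed \<open>x\<close> and a fixed \<open>r \<ge> 0\<close>.  Its quotient by
  \<open>exp (v * r)\<close> is the expectation of \<open>exp (v * \<bar>Q x\<bar> - v * (1 - M x) * r)\<close>, which tends to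
  \<open>0\<close> as \<open>r\<close> grows: \<open>M x < 1\<close> almost surely gives pointwise convergence, and
  \<open>exp (v * \<bar>Q x\<bar>)\<close> is an integrable majorant.  Hence the expectation is at most
  \<open>exp (v * r) / 2\<close> for large \<open>r\<close> and bounded for the other \<open>r\<close>
  (lemma \<open>contraction_drift\<close>).  As there are finitely many states,
  \<open>e (Suc n) \<le> e n / 2 + b\<close> with a single finite constant \<open>b\<close>, and the sequence is bounded.
  Since \<open>M x\<close> may come arbitrarily close to \<open>1\<close>, the factor \<open>1/2\<close> is gained only where
  \<open>\<bar>R n\<bar>\<close> is large.

  Above the threshold some state \<open>x\<close> has \<open>E (exp (v * \<bar>Q x\<bar>)) = \<infinity>\<close>, and irreducibility
  provides a time \<open>n\<close> with \<open>P (X n = x) > 0\<close> (lemma \<open>irreducible_chain_visits\<close>).  On the event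
  \<open>X n = x\<close> one has \<open>\<bar>R (Suc n)\<bar> \<ge> \<bar>Q\<bar> - \<bar>R n\<bar>\<close>, and the independence of \<open>Q\<close> from the state
  makes the single moment \<open>e (Suc n)\<close> infinite already.
\<close>

section \<open>Integrals over independent random elements\<close>

text \<open>
  Passing to functions of the two elements can only shrink the generated \<open>\<sigma>\<close>-algebras.
\<close>
lemma indep_rvs_compose:
  assumes S: "prob_space S" and ind: "indep_rvs S A f B g"
    and p: "p \<in> measurable A A'" and q: "q \<in> measurable B B'"
  shows "indep_rvs S A' (\<lambda>\<omega>. p (f \<omega>)) B' (\<lambda>\<omega>. q (g \<omega>))"
proof -
  interpret prob_space S by (rule S)
  have f: "f \<in> measurable S A" and g: "g \<in> measurable S B"
    and i: "indep_set (sets (vimage_algebra (space S) f A)) (sets (vimage_algebra (space S) g B))"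
    using ind by (auto simp: indep_rvs_def)
  have pf: "(\<lambda>\<omega>. p (f \<omega>)) \<in> measurable S A'" and qg: "(\<lambda>\<omega>. q (g \<omega>)) \<in> measurable S B'"
    using f g p q by measurable
  have coarser: "sets (vimage_algebra (space S) (\<lambda>\<omega>. k (u \<omega>)) N') \<subseteq> sets (vimage_algebra (space S) u N)"
    if u: "u \<in> measurable S N" and k: "k \<in> measurable N N'" for u k and N :: "'x measure" and N' :: "'y measure"
  proof (rule sets_image_in_sets)
    show "space (vimage_algebra (space S) u N) = space S" by simp
    show "(\<lambda>\<omega>. k (u \<omega>)) \<in> measurable (vimage_algebra (space S) u N) N'"
      by (rule measurable_compose[OF measurable_vimage_algebra1 k])
        (use u in \<open>auto dest: measurable_space\<close>)
  qed
  show ?thesis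
    unfolding indep_rvs_def indep_set_def
  proof (intro conjI pf qg indep_sets_mono_sets[OF i[unfolded indep_set_def]])
    fix j :: bool
    show "case_bool (sets (vimage_algebra (space S) (\<lambda>\<omega>. p (f \<omega>)) A'))
          (sets (vimage_algebra (space S) (\<lambda>\<omega>. q (g \<omega>)) B')) j
        \<subseteq> case_bool (sets (vimage_algebra (space S) f A)) (sets (vimage_algebra (space S) g B)) j"
      using coarser[OF f p] coarser[OF g q] by (cases j) simp_all
  qed
qed

text \<open>
  Independence says that the joint law is the product of the marginals, and then this is
  Tonelli's theorem.  Keeping two copies of \<open>S\<close> in the conclusion, rather than the image
  measures, lets the rule be iterated and be used from right to left.
\<close>
lemma indep_rvs_nn_integral:
  assumes S: "prob_space S" and ind: "indep_rvs S A f B g"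
    and h: "h \<in> borel_measurable (A \<Otimes>\<^sub>M B)"
  shows "(\<integral>\<^sup>+ \<omega>. h (f \<omega>, g \<omega>) \<partial>S) = (\<integral>\<^sup>+ \<omega>. \<integral>\<^sup>+ \<omega>'. h (f \<omega>, g \<omega>') \<partial>S \<partial>S)"
proof -
  interpret prob_space S by (rule S)
  have f[measurable]: "f \<in> measurable S A" and g[measurable]: "g \<in> measurable S B"
    and i: "indep_set (sets (vimage_algebra (space S) f A)) (sets (vimage_algebra (space S) g B))"
    using ind by (auto simp: indep_rvs_def)
  note h[measurable]
  interpret F: prob_space "distr S A f" by (rule prob_space_distr) simp
  interpret G: prob_space "distr S B g" by (rule prob_space_distr) simp
  have "distr S A f \<Otimes>\<^sub>M distr S B g = distr S (A \<Otimes>\<^sub>M B) (\<lambda>\<omega>. (f \<omega>, g \<omega>))"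
  proof (rule pair_measure_eqI)
    fix a b assume "a \<in> sets (distr S A f)" and "b \<in> sets (distr S B g)"
    then have [measurable]: "a \<in> sets A" "b \<in> sets B" by auto
    have "f -` a \<inter> space S \<in> sets (vimage_algebra (space S) f A)"
      "g -` b \<inter> space S \<in> sets (vimage_algebra (space S) g B)"
      by (auto intro: in_vimage_algebra)
    then have "prob ((f -` a \<inter> space S) \<inter> (g -` b \<inter> space S)) = prob (f -` a \<inter> space S) * prob (g -` b \<inter> space S)"
      using i by (rule indep_setD[rotated])
    moreover have "(\<lambda>\<omega>. (f \<omega>, g \<omega>)) -` (a \<times> b) \<inter> space S = (f -` a \<inter> space S) \<inter> (g -` b \<inter> space S)"
      by auto
    ultimately show "emeasure (distr S A f) a * emeasure (distr S B g) b
        = emeasure (distr S (A \<Otimes>\<^sub>M B) (\<lambda>\<omega>. (f \<omega>, g \<omega>))) (a \<times> b)"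
      by (simp add: emeasure_distr emeasure_eq_measure ennreal_mult)
  qed (auto intro: F.sigma_finite_measure_axioms G.sigma_finite_measure_axioms)
  then have "(\<integral>\<^sup>+ \<omega>. h (f \<omega>, g \<omega>) \<partial>S) = (\<integral>\<^sup>+ z. h z \<partial>(distr S A f \<Otimes>\<^sub>M distr S B g))"
    by (simp add: nn_integral_distr)
  also have "\<dots> = (\<integral>\<^sup>+ \<omega>. \<integral>\<^sup>+ y. h (f \<omega>, y) \<partial>distr S B g \<partial>S)"
    by (subst G.nn_integral_fst[symmetric]) (simp_all add: nn_integral_distr)
  also have "\<dots> = (\<integral>\<^sup>+ \<omega>. \<integral>\<^sup>+ \<omega>'. h (f \<omega>, g \<omega>') \<partial>S \<partial>S)"
  proof (rule nn_integral_cong)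
    fix \<omega> assume "\<omega> \<in> space S"
    then have "f \<omega> \<in> space A" using measurable_space[OF f] by simp
    then have "(\<lambda>y. h (f \<omega>, y)) \<in> borel_measurable B" by measurable
    then show "(\<integral>\<^sup>+ y. h (f \<omega>, y) \<partial>distr S B g) = (\<integral>\<^sup>+ \<omega>'. h (f \<omega>, g \<omega>') \<partial>S)"
      by (simp add: nn_integral_distr)
  qed
  finally show ?thesis .
qed

text \<open>
  If \<open>u\<close> is independent of \<open>(v, w)\<close> and \<open>v\<close> of \<open>w\<close>, then \<open>(u, v)\<close> is independent of
  \<open>w\<close>, here in integrated form.  The integral is split over three
  copies of \<open>S\<close>; the first two are then merged again by the same rule, applied to a function
  that does not look at \<open>w\<close>.
\<close>
lemma indep_rvs_triple_nn_integral:
  assumes S: "prob_space S" and uvw: "indep_rvs S A u (B \<Otimes>\<^sub>M C) (\<lambda>\<omega>. (v \<omega>, w \<omega>))"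
    and vw: "indep_rvs S B v C w" and h[measurable]: "h \<in> borel_measurable ((A \<Otimes>\<^sub>M B) \<Otimes>\<^sub>M C)"
  shows "(\<integral>\<^sup>+ \<omega>. h ((u \<omega>, v \<omega>), w \<omega>) \<partial>S) = (\<integral>\<^sup>+ \<omega>. \<integral>\<^sup>+ \<omega>'. h ((u \<omega>, v \<omega>), w \<omega>') \<partial>S \<partial>S)"
proof -
  interpret prob_space S by (rule S)
  have [measurable]: "u \<in> measurable S A" "v \<in> measurable S B" "w \<in> measurable S C"
    using uvw vw by (auto simp: indep_rvs_def)
  have "(\<integral>\<^sup>+ \<omega>. h ((u \<omega>, v \<omega>), w \<omega>) \<partial>S) = (\<integral>\<^sup>+ \<omega>. \<integral>\<^sup>+ \<omega>'. h ((u \<omega>, v \<omega>'), w \<omega>') \<partial>S \<partial>S)"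
    using indep_rvs_nn_integral[OF S uvw, of "\<lambda>(a, b, c). h ((a, b), c)"] by simp
  also have "\<dots> = (\<integral>\<^sup>+ \<omega>. \<integral>\<^sup>+ \<omega>'. \<integral>\<^sup>+ \<omega>''. h ((u \<omega>, v \<omega>'), w \<omega>'') \<partial>S \<partial>S \<partial>S)"
  proof (rule nn_integral_cong)
    fix \<omega> assume "\<omega> \<in> space S"
    then have "u \<omega> \<in> space A" using measurable_space[of u S A] by simp
    then have "(\<lambda>(b, c). h ((u \<omega>, b), c)) \<in> borel_measurable (B \<Otimes>\<^sub>M C)" by measurable
    from indep_rvs_nn_integral[OF S vw this]
    show "(\<integral>\<^sup>+ \<omega>'. h ((u \<omega>, v \<omega>'), w \<omega>') \<partial>S) = (\<integral>\<^sup>+ \<omega>'. \<integral>\<^sup>+ \<omega>''. h ((u \<omega>, v \<omega>'), w \<omega>'') \<partial>S \<partial>S)"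
      by simp
  qed
  \<comment> \<open>Independence of \<open>u\<close> and \<open>(v, w)\<close> once more, now for a function constant in its last argument.\<close>
  also have "\<dots> = (\<integral>\<^sup>+ \<omega>. \<integral>\<^sup>+ \<omega>''. h ((u \<omega>, v \<omega>), w \<omega>'') \<partial>S \<partial>S)"
    using indep_rvs_nn_integral[OF S uvw, of "\<lambda>(a, b, c). \<integral>\<^sup>+ \<omega>''. h ((a, b), w \<omega>'') \<partial>S"] by simp
  finally show ?thesis .
qed

section \<open>The state is independent of the next coefficients\<close>

text \<open>
  The path of the recursion as a deterministic function of the trajectory of the chain, the
  starting point and the coefficients; independence is transported along this function.
\<close>

primrec affine_recursion ::
  "(nat \<Rightarrow> 'e) \<Rightarrow> real \<Rightarrow> (nat \<Rightarrow> 'e \<Rightarrow> real \<times> real) \<Rightarrow> nat \<Rightarrow> real" where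
  "affine_recursion x r c 0 = r"
| "affine_recursion x r c (Suc n) = fst (c n (x n)) * affine_recursion x r c n + snd (c n (x n))"

lemma affine_recursion_cong:
  "(\<And>i. i < n \<Longrightarrow> c i = c' i) \<Longrightarrow> affine_recursion x r c n = affine_recursion x r c' n"
  by (induction n) auto

text \<open>
  Evaluation at a random state is measurable because there are only countably many states.
\<close>
lemma coeff_at_state_measurable:
  fixes x :: "'a \<Rightarrow> 'e::finite"
  assumes [measurable]: "c \<in> measurable N coeff_space" "x \<in> measurable N (count_space UNIV)"
  shows "(\<lambda>p. c p (x p)) \<in> measurable N (borel \<Otimes>\<^sub>M borel)"
proof (rule measurable_compose_countable[where f = "\<lambda>y p. c p y" and g = x])
  show "(\<lambda>p. c p y) \<in> measurable N (borel \<Otimes>\<^sub>M borel)" for y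
    by measurable
qed simp

lemma affine_recursion_measurable:
  fixes n :: nat
  defines "chain_space \<equiv> PiM UNIV (\<lambda>_. count_space (UNIV :: 'e::finite set))"
  shows "(\<lambda>((x, r), c). affine_recursion x r c n)
     \<in> borel_measurable ((chain_space \<Otimes>\<^sub>M borel) \<Otimes>\<^sub>M PiM UNIV (\<lambda>_. coeff_space))"
proof (induction n)
  case 0
  show ?case by (simp add: case_prod_beta)
next
  case (Suc n)
  note IH = Suc.IH[unfolded case_prod_beta, measurable]
  let ?N = "(chain_space \<Otimes>\<^sub>M (borel :: real measure)) \<Otimes>\<^sub>M PiM UNIV (\<lambda>_::nat. coeff_space)"
  have [measurable]: "(\<lambda>p. snd p n (fst (fst p) n)) \<in> measurable ?N (borel \<Otimes>\<^sub>M borel)"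
    by (rule coeff_at_state_measurable) (simp_all add: chain_space_def)
  show ?case
    unfolding affine_recursion.simps case_prod_beta by measurable
qed

text \<open>
  The value \<open>r n\<close> depends on the chain, the starting point and the coefficients before time
  \<open>n\<close> only.  The coefficients at time \<open>n\<close> are independent of the earlier ones, and the whole
  coefficient sequence is independent of the chain and the starting point, so they are
  independent of \<open>(X n, r n)\<close>.
\<close>
lemma state_coefficient_nn_integral:
  fixes X :: "nat \<Rightarrow> 'w \<Rightarrow> 'e::finite" and r\<^sub>0 :: "'w \<Rightarrow> real"
    and c :: "nat \<Rightarrow> 'w \<Rightarrow> 'e \<Rightarrow> real \<times> real"
  assumes S: "prob_space S"
    and seq: "prob_space.indep_vars S (\<lambda>_. coeff_space) c UNIV"
    and ind: "indep_rvs S (PiM UNIV (\<lambda>_. count_space UNIV) \<Otimes>\<^sub>M borel) (\<lambda>\<omega>. ((\<lambda>n. X n \<omega>), r\<^sub>0 \<omega>))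
        (PiM UNIV (\<lambda>_. coeff_space)) (\<lambda>\<omega> n. c n \<omega>)"
    and h[measurable]: "h \<in> borel_measurable ((count_space UNIV \<Otimes>\<^sub>M borel) \<Otimes>\<^sub>M coeff_space)"
  defines "r n \<omega> \<equiv> affine_recursion (\<lambda>n. X n \<omega>) (r\<^sub>0 \<omega>) (\<lambda>n. c n \<omega>) n"
  shows "(\<integral>\<^sup>+ \<omega>. h ((X n \<omega>, r n \<omega>), c n \<omega>) \<partial>S)
    = (\<integral>\<^sup>+ \<omega>. \<integral>\<^sup>+ \<omega>'. h ((X n \<omega>, r n \<omega>), c n \<omega>') \<partial>S \<partial>S)"
proof -
  interpret prob_space S by (rule S)
  \<comment> \<open>Coefficients from time \<open>n\<close> on are overwritten by zeros, so that the past is again a full sequence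
      and \<open>affine_recursion\<close> applies to it.\<close>
  define past where "past d = (\<lambda>i. if i < n then d i else (\<lambda>_. (0, 0)))"
    for d :: "nat \<Rightarrow> 'e \<Rightarrow> real \<times> real"
  let ?C = "PiM UNIV (\<lambda>_::nat. coeff_space) :: (nat \<Rightarrow> 'e \<Rightarrow> real \<times> real) measure"
  have past_meas: "past \<in> measurable (PiM J (\<lambda>_. coeff_space)) ?C" if "{..<n} \<subseteq> J" for J
  proof (rule measurable_PiM_single')
    fix i
    show "(\<lambda>d. past d i) \<in> measurable (PiM J (\<lambda>_. coeff_space)) coeff_space"
    proof (cases "i < n")
      case True
      then have "i \<in> J" using that by auto
      then show ?thesis using True by (simp add: past_def)
    next
      case False
      then show ?thesis by (simp add: past_def space_PiM space_pair_measure)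
    qed
  qed (simp add: past_def space_PiM space_pair_measure)
  have [measurable]: "past \<in> measurable ?C ?C" by (rule past_meas) simp
  have "indep_var (PiM {..<n} (\<lambda>_. coeff_space)) (\<lambda>\<omega>. restrict (\<lambda>i. c i \<omega>) {..<n})
      (PiM {n} (\<lambda>_. coeff_space)) (\<lambda>\<omega>. restrict (\<lambda>i. c i \<omega>) {n})"
    by (rule indep_var_restrict[OF seq]) auto
  then have "indep_rvs S (PiM {..<n} (\<lambda>_. coeff_space)) (\<lambda>\<omega>. restrict (\<lambda>i. c i \<omega>) {..<n})
      (PiM {n} (\<lambda>_. coeff_space)) (\<lambda>\<omega>. restrict (\<lambda>i. c i \<omega>) {n})"
    unfolding indep_var_eq indep_rvs_def sets_vimage_algebra by blast
  from indep_rvs_compose[OF S this past_meas[OF order_refl] measurable_component_singleton[of n]]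
  have vw: "indep_rvs S ?C (\<lambda>\<omega>. past (\<lambda>i. c i \<omega>)) coeff_space (c n)"
    by (simp add: past_def cong: if_cong)
  have uvw: "indep_rvs S (PiM UNIV (\<lambda>_. count_space UNIV) \<Otimes>\<^sub>M borel) (\<lambda>\<omega>. ((\<lambda>n. X n \<omega>), r\<^sub>0 \<omega>))
      (?C \<Otimes>\<^sub>M coeff_space) (\<lambda>\<omega>. (past (\<lambda>i. c i \<omega>), c n \<omega>))"
    by (rule indep_rvs_compose[OF S ind, where p = "\<lambda>z. z" and q = "\<lambda>d. (past d, d n)"]) measurable
  have r: "r n \<omega> = affine_recursion (\<lambda>n. X n \<omega>) (r\<^sub>0 \<omega>) (past (\<lambda>n. c n \<omega>)) n" for \<omega>
    unfolding r_def by (rule affine_recursion_cong) (simp add: past_def)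
  have "(\<lambda>(((x, s), d), e). h ((x n, affine_recursion x s d n), e))
      \<in> borel_measurable (((PiM UNIV (\<lambda>_. count_space UNIV) \<Otimes>\<^sub>M borel) \<Otimes>\<^sub>M ?C) \<Otimes>\<^sub>M coeff_space)"
    using affine_recursion_measurable[of n] unfolding case_prod_beta by measurable
  from indep_rvs_triple_nn_integral[OF S uvw vw this] show ?thesis
    by (simp add: r)
qed

section \<open>The drift inequality\<close>

text \<open>
  For \<open>0 \<le> M < 1\<close> the integrand is \<open>exp (v * r)\<close> times
  \<open>exp (v * \<bar>Q\<bar> - v * (1 - M) * r)\<close>.  The second factor is decreasing in \<open>r\<close>, and dominated
  convergence yields a threshold \<open>k\<close> at which its expectation is at most \<open>1/2\<close>; this settles
  \<open>r \<ge> k\<close>.  For \<open>r < k\<close> the whole integrand is at most \<open>exp (v * k) * exp (v * \<bar>Q\<bar>)\<close>, whose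
  expectation serves as \<open>b\<close>.
\<close>

lemma contraction_drift:
  fixes M Q :: "'w \<Rightarrow> real"
  assumes S: "prob_space S" and [measurable]: "M \<in> borel_measurable S" "Q \<in> borel_measurable S"
    and M: "AE \<omega> in S. 0 \<le> M \<omega> \<and> M \<omega> < 1" and v: "v > 0" and fin: "exp_moment S Q v < \<infinity>"
  obtains b where "b < \<infinity>"
    "\<And>r. r \<ge> 0 \<Longrightarrow> (\<integral>\<^sup>+ \<omega>. ennreal (exp (v * (\<bar>M \<omega>\<bar> * r + \<bar>Q \<omega>\<bar>))) \<partial>S) \<le> ennreal (1/2) * ennreal (exp (v * r)) + b"
proof -
  define I where "I k = (\<integral>\<^sup>+ \<omega>. ennreal (exp (v * \<bar>Q \<omega>\<bar> - v * (1 - M \<omega>) * real k)) \<partial>S)" for k :: nat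
  have "I \<longlonglongrightarrow> (\<integral>\<^sup>+ \<omega>. 0 \<partial>S)"
    unfolding I_def
  proof (rule nn_integral_dominated_convergence[where w = "\<lambda>\<omega>. ennreal (exp (v * \<bar>Q \<omega>\<bar>))"])
    show "AE \<omega> in S. ennreal (exp (v * \<bar>Q \<omega>\<bar> - v * (1 - M \<omega>) * real k)) \<le> ennreal (exp (v * \<bar>Q \<omega>\<bar>))" for k
      using M by eventually_elim (use v in \<open>auto intro!: ennreal_leI mult_nonneg_nonneg\<close>)
    show "(\<integral>\<^sup>+ \<omega>. ennreal (exp (v * \<bar>Q \<omega>\<bar>)) \<partial>S) < \<infinity>"
      using fin by (simp add: exp_moment_def)
    show "AE \<omega> in S. (\<lambda>k. ennreal (exp (v * \<bar>Q \<omega>\<bar> - v * (1 - M \<omega>) * real k))) \<longlonglongrightarrow> 0"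
      using M
    proof eventually_elim
      case (elim \<omega>)
      then have "v * (1 - M \<omega>) > 0" using v by simp
      moreover have "(\<lambda>k. exp (q - a * real k)) \<longlonglongrightarrow> 0" if "a > 0" for q a :: real
        using that by real_asymp
      ultimately have "(\<lambda>k. exp (v * \<bar>Q \<omega>\<bar> - v * (1 - M \<omega>) * real k)) \<longlonglongrightarrow> 0"
        by blast
      then show ?case using tendsto_ennrealI by fastforce
    qed
  qed auto
  then have "eventually (\<lambda>k. I k < ennreal (1/2)) sequentially"
    by (intro order_tendstoD(2)[of I 0]) (simp_all add: ennreal_less_zero_iff del: ennreal_half)
  then obtain k where k: "I k \<le> ennreal (1/2)"
    by (auto simp: eventually_sequentially intro: less_imp_le)
  show ?thesis
  proof
    show "ennreal (exp (v * real k)) * exp_moment S Q v < \<infinity>"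
      using fin by (simp add: ennreal_mult_less_top)
    fix r :: real assume r: "r \<ge> 0"
    let ?J = "\<integral>\<^sup>+ \<omega>. ennreal (exp (v * (\<bar>M \<omega>\<bar> * r + \<bar>Q \<omega>\<bar>))) \<partial>S"
    show "?J \<le> ennreal (1/2) * ennreal (exp (v * r)) + ennreal (exp (v * real k)) * exp_moment S Q v"
    proof (cases "real k \<le> r")
      case True
      have "?J \<le> (\<integral>\<^sup>+ \<omega>. ennreal (exp (v * r)) * ennreal (exp (v * \<bar>Q \<omega>\<bar> - v * (1 - M \<omega>) * real k)) \<partial>S)"
      proof (rule nn_integral_mono_AE)
        show "AE \<omega> in S. ennreal (exp (v * (\<bar>M \<omega>\<bar> * r + \<bar>Q \<omega>\<bar>)))
          \<le> ennreal (exp (v * r)) * ennreal (exp (v * \<bar>Q \<omega>\<bar> - v * (1 - M \<omega>) * real k))"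
          using M
        proof eventually_elim
          case (elim \<omega>)
          then have "v * (1 - M \<omega>) * real k \<le> v * (1 - M \<omega>) * r"
            using v True by (intro mult_left_mono) auto
          then show ?case
            using elim by (auto simp: ennreal_mult[symmetric] exp_add[symmetric] algebra_simps intro!: ennreal_leI)
        qed
      qed
      also have "\<dots> = ennreal (exp (v * r)) * I k"
        unfolding I_def by (rule nn_integral_cmult) measurable
      also have "\<dots> \<le> ennreal (1/2) * ennreal (exp (v * r))"
        by (subst mult.commute) (rule mult_right_mono[OF k zero_le])
      finally show ?thesis by (rule order_trans) simp
    next
      case False
      have "?J \<le> (\<integral>\<^sup>+ \<omega>. ennreal (exp (v * real k)) * ennreal (exp (v * \<bar>Q \<omega>\<bar>)) \<partial>S)"
      proof (rule nn_integral_mono_AE)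
        show "AE \<omega> in S. ennreal (exp (v * (\<bar>M \<omega>\<bar> * r + \<bar>Q \<omega>\<bar>)))
          \<le> ennreal (exp (v * real k)) * ennreal (exp (v * \<bar>Q \<omega>\<bar>))"
          using M
        proof eventually_elim
          case (elim \<omega>)
          then have "M \<omega> * r \<le> 1 * real k"
            using r False by (intro mult_mono) auto
          then have "v * (\<bar>M \<omega>\<bar> * r + \<bar>Q \<omega>\<bar>) \<le> v * (real k + \<bar>Q \<omega>\<bar>)"
            using v elim by (intro mult_left_mono) auto
          then show ?case
            by (simp add: ennreal_mult[symmetric] exp_add[symmetric] distrib_left)
        qed
      qed
      also have "\<dots> = ennreal (exp (v * real k)) * exp_moment S Q v"
        unfolding exp_moment_def by (rule nn_integral_cmult) measurable
      finally show ?thesis by (rule order_trans) simp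
    qed
  qed
qed

text \<open>
  The interval below \<open>e 0 + 2 * b\<close> is mapped into itself by \<open>y \<mapsto> y / 2 + b\<close>.
\<close>
lemma half_drift_bounded:
  fixes e :: "nat \<Rightarrow> ennreal"
  assumes step: "\<And>n. e (Suc n) \<le> ennreal (1/2) * e n + b" and b: "b < \<infinity>" and e0: "e 0 < \<infinity>"
  shows "(SUP n. e n) < \<infinity>"
proof -
  have "ennreal (1/2) + ennreal (1/2) = 1"
    by (subst ennreal_plus[symmetric]) simp_all
  then have half: "ennreal (1/2) * y + ennreal (1/2) * y = y" for y
    by (metis distrib_right mult_1)
  have "e n \<le> e 0 + (b + b)" for n
  proof (induction n)
    case (Suc n)
    have "e (Suc n) \<le> ennreal (1/2) * (e 0 + (b + b)) + b"
      using step[of n] Suc by (meson add_right_mono mult_left_mono order_trans zero_le)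
    also have "\<dots> = ennreal (1/2) * e 0 + (ennreal (1/2) * b + ennreal (1/2) * b + b)"
      by (simp add: distrib_left add.assoc)
    also have "\<dots> = ennreal (1/2) * e 0 + (b + b)"
      unfolding half ..
    also have "\<dots> \<le> 1 * e 0 + (b + b)"
      by (intro add_right_mono mult_right_mono ennreal_le_1[THEN iffD2]) simp_all
    finally show ?case by simp
  qed simp
  then have "(SUP n. e n) \<le> e 0 + (b + b)" by (rule SUP_least)
  also have "\<dots> < \<infinity>" using b e0 by simp
  finally show ?thesis .
qed

section \<open>States visited with positive probability\<close>

text \<open>
  The Markov property is a statement about complete histories, so the induction carries a whole
  path \<open>s\<close> of positive probability and extends it by one state at a time.
\<close>

lemma markov_chain_n_step_reaches:
  assumes S: "prob_space S" and chain: "markov_chain S K X"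
    and "\<P>(\<omega> in S. \<forall>i\<le>n. X i \<omega> = s i) > 0" and "n_step K m (s n) y > 0"
  shows "\<P>(\<omega> in S. X (n + m) \<omega> = y) > 0"
  using assms(3,4)
proof (induction m arbitrary: n s)
  case 0
  interpret prob_space S by (rule S)
  have [measurable]: "X i \<in> measurable S (count_space UNIV)" for i
    using chain by (simp add: markov_chain_def)
  have "s n = y" using 0 by (simp split: if_splits)
  then have "\<P>(\<omega> in S. \<forall>i\<le>n. X i \<omega> = s i) \<le> \<P>(\<omega> in S. X n \<omega> = y)"
    by (intro finite_measure_mono) auto
  then show ?case using 0 by simp
next
  case (Suc m)
  interpret prob_space S by (rule S)
  have [measurable]: "X i \<in> measurable S (count_space UNIV)" for i
    using chain by (simp add: markov_chain_def)
  have "\<exists>z. K (s n) z * n_step K m z y > 0"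
  proof (rule ccontr)
    assume "\<nexists>z. K (s n) z * n_step K m z y > 0"
    then have "(\<Sum>z\<in>UNIV. K (s n) z * n_step K m z y) \<le> 0"
      by (intro sum_nonpos) (auto simp: not_less)
    then show False using Suc.prems by simp
  qed
  then obtain z where z: "K (s n) z * n_step K m z y > 0" by blast
  moreover have "K (s n) z \<ge> 0"
    using chain by (simp add: markov_chain_def stochastic_matrix_def)
  ultimately have K: "K (s n) z > 0" and step: "n_step K m z y > 0"
    by (auto simp: zero_less_mult_iff)
  \<comment> \<open>The history extended by \<open>z\<close>, from which \<open>y\<close> is reachable in \<open>m\<close> further steps.\<close>
  define t where "t = s(Suc n := z)"
  have "\<P>(\<omega> in S. X (Suc n) \<omega> = z \<bar> (\<forall>i\<le>n. X i \<omega> = s i)) > 0"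
    using chain Suc.prems(1) K by (simp add: markov_chain_def)
  then have "\<P>(\<omega> in S. X (Suc n) \<omega> = z \<and> (\<forall>i\<le>n. X i \<omega> = s i)) > 0"
    using Suc.prems(1) by (simp add: cond_prob_def zero_less_divide_iff)
  also have "\<P>(\<omega> in S. X (Suc n) \<omega> = z \<and> (\<forall>i\<le>n. X i \<omega> = s i)) = \<P>(\<omega> in S. \<forall>i\<le>Suc n. X i \<omega> = t i)"
    by (intro arg_cong[where f = prob]) (auto simp: t_def le_Suc_eq)
  finally show ?case
    using Suc.IH[of "Suc n" t] step by (simp add: t_def)
qed

text \<open>
  The initial law is arbitrary, but on a finite state space it has an atom, and every state
  is accessible from that atom.
\<close>
lemma irreducible_chain_visits:
  assumes S: "prob_space S" and chain: "markov_chain S K X" and irred: "irreducible_chain K"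
  obtains n where "\<P>(\<omega> in S. X n \<omega> = y) > 0"
proof -
  interpret prob_space S by (rule S)
  have [measurable]: "X i \<in> measurable S (count_space UNIV)" for i
    using chain by (simp add: markov_chain_def)
  have "\<exists>x. \<P>(\<omega> in S. X 0 \<omega> = x) > 0"
  proof (rule ccontr)
    assume "\<nexists>x. \<P>(\<omega> in S. X 0 \<omega> = x) > 0"
    then have "\<P>(\<omega> in S. X 0 \<omega> = x) = 0" for x
      by (simp add: not_less measure_le_0_iff)
    then have "AE \<omega> in S. \<omega> \<notin> {\<omega> \<in> space S. X 0 \<omega> = x}" for x
      by (subst prob_eq_0[symmetric]) simp_all
    then have "AE \<omega> in S. X 0 \<omega> \<noteq> x" for x
      by (simp cong: AE_cong_simp)
    then have "AE \<omega> in S. \<forall>x. X 0 \<omega> \<noteq> x"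
      unfolding AE_all_countable by blast
    then show False by simp
  qed
  then obtain x where x: "\<P>(\<omega> in S. \<forall>i\<le>0. X i \<omega> = x) > 0" by auto
  obtain n where "n_step K n x y > 0"
    using irred by (auto simp: irreducible_chain_def)
  with markov_chain_n_step_reaches[OF S chain x this] show ?thesis by (intro that)
qed

section \<open>The dichotomy\<close>


theorem proposition3p1:
  fixes S :: "'w measure"
    and K :: "'e::finite \<Rightarrow> 'e \<Rightarrow> real"
    and X :: "nat \<Rightarrow> 'w \<Rightarrow> 'e"
    and M Q :: "'e \<Rightarrow> 'w \<Rightarrow> real"
    and Mn Qn :: "nat \<Rightarrow> 'e \<Rightarrow> 'w \<Rightarrow> real"
    and R :: "nat \<Rightarrow> 'w \<Rightarrow> real"
    and vQ :: "'e \<Rightarrow> ereal"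
  assumes prob: "prob_space S"
    and chain: "markov_chain S K X"
    and irred: "irreducible_chain K"
    and recur: "recurrent_chain K"
    and M_rv: "\<And>x. M x \<in> borel_measurable S"
    and Q_rv: "\<And>x. Q x \<in> borel_measurable S"
    and iid_indep: "prob_space.indep_vars S (\<lambda>_. coeff_space)
                      (\<lambda>n \<omega> x. (Mn n x \<omega>, Qn n x \<omega>)) UNIV"
    and iid_law: "\<And>n. distr S coeff_space (\<lambda>\<omega> x. (Mn n x \<omega>, Qn n x \<omega>)) =
                       distr S coeff_space (\<lambda>\<omega> x. (M x \<omega>, Q x \<omega>))"
    and M_range: "\<And>x. \<P>(\<omega> in S. 0 \<le> M x \<omega> \<and> M x \<omega> < 1) = 1"
    and vQ_pos: "\<And>x. 0 < vQ x"
    and Q_moment_fin: "\<And>x v. ereal v < vQ x \<Longrightarrow> exp_moment S (Q x) v < \<infinity>"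
    and Q_moment_inf: "\<And>x v. ereal v > vQ x \<Longrightarrow> exp_moment S (Q x) v = \<infinity>"
    and R0_rv: "R 0 \<in> borel_measurable S"
    and R0_moment: "\<And>v. v \<ge> 0 \<Longrightarrow> exp_moment S (R 0) v < \<infinity>"
    and indep: "indep_rvs S
                  (PiM UNIV (\<lambda>_. count_space UNIV) \<Otimes>\<^sub>M borel) (\<lambda>\<omega>. ((\<lambda>n. X n \<omega>), R 0 \<omega>))
                  (PiM UNIV (\<lambda>_. coeff_space)) (\<lambda>\<omega> n x. (Mn n x \<omega>, Qn n x \<omega>))"
    and R_rec: "\<And>n \<omega>. \<omega> \<in> space S \<Longrightarrow>
                  R (Suc n) \<omega> = Mn n (X n \<omega>) \<omega> * R n \<omega> + Qn n (X n \<omega>) \<omega>"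
  shows "(\<forall>v::real. ereal v < (INF x. vQ x) \<longrightarrow> (SUP n. exp_moment S (R n) v) < \<infinity>) \<and>
         (\<forall>v::real. ereal v > (INF x. vQ x) \<longrightarrow> (SUP n. exp_moment S (R n) v) = \<infinity>)"
proof (intro conjI allI impI)
  interpret prob_space S by (rule prob)
  define c where "c n \<omega> x = (Mn n x \<omega>, Qn n x \<omega>)" for n \<omega> x
  define MQ where "MQ \<omega> x = (M x \<omega>, Q x \<omega>)" for \<omega> x
  note M_rv[measurable] Q_rv[measurable]
  have X[measurable]: "X n \<in> measurable S (count_space UNIV)" for n
    using chain by (simp add: markov_chain_def)
  have c[measurable]: "c n \<in> measurable S coeff_space" for n
    using iid_indep by (simp add: indep_vars_def c_def[abs_def])
  have MQ[measurable]: "MQ \<in> measurable S coeff_space"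
    unfolding MQ_def by (rule measurable_PiM_single') (auto simp: space_pair_measure)
  have M_AE: "AE \<omega> in S. 0 \<le> M x \<omega> \<and> M x \<omega> < 1" for x
    using M_range[of x] by (subst (asm) prob_eq_1) auto
  have R_eq: "R n \<omega> = affine_recursion (\<lambda>n. X n \<omega>) (R 0 \<omega>) (\<lambda>n. c n \<omega>) n" if "\<omega> \<in> space S" for n \<omega>
    by (induction n) (simp_all add: R_rec[OF that] c_def)
  have R[measurable]: "R n \<in> borel_measurable S" for n
  proof (induction n)
    case 0
    show ?case by (rule R0_rv)
  next
    case (Suc n)
    note Suc[measurable]
    have [measurable]: "(\<lambda>\<omega>. c n \<omega> (X n \<omega>)) \<in> measurable S (borel \<Otimes>\<^sub>M borel)"
      by (rule coeff_at_state_measurable[OF c X])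
    have "(\<lambda>\<omega>. fst (c n \<omega> (X n \<omega>)) * R n \<omega> + snd (c n \<omega> (X n \<omega>))) \<in> borel_measurable S"
      by measurable
    then show ?case
      by (rule measurable_cong[THEN iffD1, rotated]) (simp add: R_rec c_def)
  qed
  have one_step: "(\<integral>\<^sup>+ \<omega>. h ((X n \<omega>, R n \<omega>), c n \<omega>) \<partial>S) = (\<integral>\<^sup>+ \<omega>. \<integral>\<^sup>+ \<omega>'. h ((X n \<omega>, R n \<omega>), MQ \<omega>') \<partial>S \<partial>S)"
    if h[measurable]: "h \<in> borel_measurable ((count_space UNIV \<Otimes>\<^sub>M borel) \<Otimes>\<^sub>M coeff_space)" for h n
  proof -
    have "(\<integral>\<^sup>+ \<omega>. h ((X n \<omega>, R n \<omega>), c n \<omega>) \<partial>S) = (\<integral>\<^sup>+ \<omega>. \<integral>\<^sup>+ \<omega>'. h ((X n \<omega>, R n \<omega>), c n \<omega>') \<partial>S \<partial>S)"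
      using state_coefficient_nn_integral[OF prob iid_indep indep h, of n]
      by (simp add: R_eq[of _ n] c_def[abs_def] cong: nn_integral_cong_simp)
    also have "\<dots> = (\<integral>\<^sup>+ \<omega>. \<integral>\<^sup>+ \<omega>'. h ((X n \<omega>, R n \<omega>), MQ \<omega>') \<partial>S \<partial>S)"
    proof (rule nn_integral_cong)
      fix \<omega>
      have *: "(\<integral>\<^sup>+ d. h ((X n \<omega>, R n \<omega>), d) \<partial>distr S coeff_space k) = (\<integral>\<^sup>+ \<omega>'. h ((X n \<omega>, R n \<omega>), k \<omega>') \<partial>S)"
        if "k \<in> measurable S coeff_space" for k
        using that by (rule nn_integral_distr) measurable
      have "distr S coeff_space (c n) = distr S coeff_space MQ"
        using iid_law[of n] by (simp add: c_def[abs_def] MQ_def[abs_def])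
      then show "(\<integral>\<^sup>+ \<omega>'. h ((X n \<omega>, R n \<omega>), c n \<omega>') \<partial>S) = (\<integral>\<^sup>+ \<omega>'. h ((X n \<omega>, R n \<omega>), MQ \<omega>') \<partial>S)"
        using *[OF c[of n]] *[OF MQ] by metis
    qed
    finally show ?thesis .
  qed
  {
    fix v :: real
    assume v_less: "ereal v < (INF x. vQ x)"
    show "(SUP n. exp_moment S (R n) v) < \<infinity>"
    proof (cases "v > 0")
      \<comment> \<open>A nonpositive \<open>v\<close> is allowed; then all integrands are at most \<open>1\<close>.\<close>
      case False
      have "exp_moment S (R n) v \<le> (\<integral>\<^sup>+ \<omega>. 1 \<partial>S)" for n
        unfolding exp_moment_def
        using False by (intro nn_integral_mono) (auto simp: mult_nonpos_nonneg)
      then have "(SUP n. exp_moment S (R n) v) \<le> 1"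
        by (intro SUP_least) (simp add: emeasure_space_1)
      then show ?thesis using le_less_trans by fastforce
    next
      case True
      have "\<exists>b. b < \<infinity> \<and> (\<forall>r\<ge>0. (\<integral>\<^sup>+ \<omega>. ennreal (exp (v * (\<bar>M x \<omega>\<bar> * r + \<bar>Q x \<omega>\<bar>))) \<partial>S)
          \<le> ennreal (1/2) * ennreal (exp (v * r)) + b)" for x
      proof -
        have "ereal v < vQ x"
          using v_less INF_lower[of x UNIV vQ] by (rule less_le_trans) simp
        from contraction_drift[OF prob M_rv Q_rv M_AE True Q_moment_fin[OF this]]
        show ?thesis by blast
      qed
      then obtain b where b_fin: "b x < \<infinity>"
        and b: "r \<ge> 0 \<Longrightarrow> (\<integral>\<^sup>+ \<omega>. ennreal (exp (v * (\<bar>M x \<omega>\<bar> * r + \<bar>Q x \<omega>\<bar>))) \<partial>S)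
          \<le> ennreal (1/2) * ennreal (exp (v * r)) + b x" for x r
        by metis
      show ?thesis
      proof (rule half_drift_bounded)
        \<comment> \<open>The sum over the finite state space dominates the constants of all states at once.\<close>
        show "(\<Sum>x\<in>UNIV. b x) < \<infinity>" using b_fin by simp
        show "exp_moment S (R 0) v < \<infinity>" using R0_moment[of v] True by simp
        fix n
        let ?h = "\<lambda>((x, r), d). ennreal (exp (v * (\<bar>fst (d x)\<bar> * \<bar>r\<bar> + \<bar>snd (d x)\<bar>)))"
        have "exp_moment S (R (Suc n)) v \<le> (\<integral>\<^sup>+ \<omega>. ?h ((X n \<omega>, R n \<omega>), c n \<omega>) \<partial>S)"
          unfolding exp_moment_def
        proof (rule nn_integral_mono)
          fix \<omega> assume "\<omega> \<in> space S"
          then have "\<bar>R (Suc n) \<omega>\<bar> \<le> \<bar>fst (c n \<omega> (X n \<omega>))\<bar> * \<bar>R n \<omega>\<bar> + \<bar>snd (c n \<omega> (X n \<omega>))\<bar>"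
            using abs_triangle_ineq[of "Mn n (X n \<omega>) \<omega> * R n \<omega>"]
            by (simp add: R_rec c_def abs_mult)
          then show "ennreal (exp (v * \<bar>R (Suc n) \<omega>\<bar>)) \<le> ?h ((X n \<omega>, R n \<omega>), c n \<omega>)"
            using True by (auto intro!: ennreal_leI mult_left_mono)
        qed
        also have "\<dots> = (\<integral>\<^sup>+ \<omega>. \<integral>\<^sup>+ \<omega>'. ?h ((X n \<omega>, R n \<omega>), MQ \<omega>') \<partial>S \<partial>S)"
        proof (rule one_step[of ?h n])
          let ?N = "(count_space (UNIV :: 'e set) \<Otimes>\<^sub>M (borel :: real measure))
              \<Otimes>\<^sub>M (coeff_space :: ('e \<Rightarrow> real \<times> real) measure)"
          have [measurable]: "(\<lambda>p. snd p (fst (fst p))) \<in> measurable ?N (borel \<Otimes>\<^sub>M borel)"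
            by (rule coeff_at_state_measurable[of snd ?N "\<lambda>p. fst (fst p)"]) measurable
          show "?h \<in> borel_measurable ?N"
            unfolding case_prod_beta by measurable
        qed
        also have "\<dots> \<le> (\<integral>\<^sup>+ \<omega>. ennreal (1/2) * ennreal (exp (v * \<bar>R n \<omega>\<bar>)) + (\<Sum>x\<in>UNIV. b x) \<partial>S)"
        proof (rule nn_integral_mono)
          fix \<omega>
          have "(\<integral>\<^sup>+ \<omega>'. ?h ((X n \<omega>, R n \<omega>), MQ \<omega>') \<partial>S)
              \<le> ennreal (1/2) * ennreal (exp (v * \<bar>R n \<omega>\<bar>)) + b (X n \<omega>)"
            using b[of "\<bar>R n \<omega>\<bar>" "X n \<omega>"] by (simp add: MQ_def)
          also have "b (X n \<omega>) \<le> (\<Sum>x\<in>UNIV. b x)"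
            by (rule member_le_sum) auto
          finally show "(\<integral>\<^sup>+ \<omega>'. ?h ((X n \<omega>, R n \<omega>), MQ \<omega>') \<partial>S)
              \<le> ennreal (1/2) * ennreal (exp (v * \<bar>R n \<omega>\<bar>)) + (\<Sum>x\<in>UNIV. b x)"
            by (simp add: add_left_mono)
        qed
        also have "\<dots> = ennreal (1/2) * exp_moment S (R n) v + (\<Sum>x\<in>UNIV. b x)"
          unfolding exp_moment_def
          by (subst nn_integral_add) (auto simp: nn_integral_cmult emeasure_space_1)
        finally show "exp_moment S (R (Suc n)) v
            \<le> ennreal (1/2) * exp_moment S (R n) v + (\<Sum>x\<in>UNIV. b x)" .
      qed
    qed
  next
    fix v :: real
    assume "ereal v > (INF x. vQ x)"
    then obtain x where x: "ereal v > vQ x" by (auto simp: INF_less_iff)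
    then have v: "v > 0" using vQ_pos[of x] by (metis ereal_less(2) less_trans)
    obtain n where n: "\<P>(\<omega> in S. X n \<omega> = x) > 0"
      using irreducible_chain_visits[OF prob chain irred] .
    \<comment> \<open>A lower bound for \<open>exp (v * \<bar>R (Suc n)\<bar>)\<close>, cut down to the event \<open>X n = x\<close>.\<close>
    let ?h = "\<lambda>((y, r), d). ennreal (exp (v * (\<bar>snd (d x)\<bar> - \<bar>fst (d x)\<bar> * \<bar>r\<bar>))) * indicator {x} y"
    have inner: "(\<integral>\<^sup>+ \<omega>'. ?h ((X n \<omega>, R n \<omega>), MQ \<omega>') \<partial>S) = \<infinity> * indicator {\<omega>. X n \<omega> = x} \<omega>" for \<omega>
    proof (cases "X n \<omega> = x")
      case True
      have "\<infinity> = ennreal (exp (- v * \<bar>R n \<omega>\<bar>)) * exp_moment S (Q x) v"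
        using Q_moment_inf[OF x] by (simp add: ennreal_mult_top)
      also have "\<dots> = (\<integral>\<^sup>+ \<omega>'. ennreal (exp (- v * \<bar>R n \<omega>\<bar>)) * ennreal (exp (v * \<bar>Q x \<omega>'\<bar>)) \<partial>S)"
        unfolding exp_moment_def by (rule nn_integral_cmult[symmetric]) measurable
      also have "\<dots> \<le> (\<integral>\<^sup>+ \<omega>'. ?h ((X n \<omega>, R n \<omega>), MQ \<omega>') \<partial>S)"
      proof (rule nn_integral_mono_AE)
        show "AE \<omega>' in S. ennreal (exp (- v * \<bar>R n \<omega>\<bar>)) * ennreal (exp (v * \<bar>Q x \<omega>'\<bar>))
            \<le> ?h ((X n \<omega>, R n \<omega>), MQ \<omega>')"
          using M_AE[of x]
        proof eventually_elim
          case (elim \<omega>')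
          then have "\<bar>M x \<omega>'\<bar> * \<bar>R n \<omega>\<bar> \<le> 1 * \<bar>R n \<omega>\<bar>"
            by (intro mult_right_mono) auto
          then have "v * (\<bar>Q x \<omega>'\<bar> - \<bar>R n \<omega>\<bar>) \<le> v * (\<bar>Q x \<omega>'\<bar> - \<bar>M x \<omega>'\<bar> * \<bar>R n \<omega>\<bar>)"
            using v by (intro mult_left_mono) auto
          then show ?case
            using True by (simp add: MQ_def ennreal_mult[symmetric] exp_add[symmetric] right_diff_distrib)
        qed
      qed
      finally show ?thesis using True by (simp add: top_unique)
    qed simp
    have "(\<integral>\<^sup>+ \<omega>. ?h ((X n \<omega>, R n \<omega>), c n \<omega>) \<partial>S) = (\<integral>\<^sup>+ \<omega>. \<integral>\<^sup>+ \<omega>'. ?h ((X n \<omega>, R n \<omega>), MQ \<omega>') \<partial>S \<partial>S)"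
    proof (rule one_step[of ?h n])
      show "?h \<in> borel_measurable ((count_space UNIV \<Otimes>\<^sub>M borel) \<Otimes>\<^sub>M coeff_space)"
        unfolding case_prod_beta by measurable
    qed
    also have "\<dots> = (\<integral>\<^sup>+ \<omega>. \<infinity> * indicator {\<omega> \<in> space S. X n \<omega> = x} \<omega> \<partial>S)"
      unfolding inner by (intro nn_integral_cong) (simp add: indicator_def)
    also have "\<dots> = \<infinity> * emeasure S {\<omega> \<in> space S. X n \<omega> = x}"
      by (rule nn_integral_cmult_indicator) measurable
    also have "\<dots> = \<infinity>"
      using n by (simp add: emeasure_eq_measure ennreal_top_mult)
    finally have "\<infinity> = (\<integral>\<^sup>+ \<omega>. ?h ((X n \<omega>, R n \<omega>), c n \<omega>) \<partial>S)" by simp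
    also have "\<dots> \<le> exp_moment S (R (Suc n)) v"
      unfolding exp_moment_def
    proof (rule nn_integral_mono)
      fix \<omega> assume \<omega>: "\<omega> \<in> space S"
      show "?h ((X n \<omega>, R n \<omega>), c n \<omega>) \<le> ennreal (exp (v * \<bar>R (Suc n) \<omega>\<bar>))"
      proof (cases "X n \<omega> = x")
        case True
        have "\<bar>snd (c n \<omega> x)\<bar> - \<bar>fst (c n \<omega> x) * R n \<omega>\<bar> \<le> \<bar>R (Suc n) \<omega>\<bar>"
          using True by (simp add: R_rec[OF \<omega>] c_def)
        then show ?thesis
          using True v by (auto simp: abs_mult intro!: ennreal_leI mult_left_mono)
      qed simp
    qed
    also have "\<dots> \<le> (SUP n. exp_moment S (R n) v)" by (rule SUP_upper) simp
    finally show "(SUP n. exp_moment S (R n) v) = \<infinity>" by (simp add: top_unique)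
  }
qed

end
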